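(* Let $a,b\ge0$, let $f\in C^1(\mathbb R)$ be Lipschitz, let $\mathcal G_h,\mathcal L_h\in\mathbb R^{N_x^2\times N_x^2}$ be self-adjoint, non-negative definite and commuting, and let $J_f=cI$ with $c\ge0$. Let $h_t>0$ and $T=N_th_t$ ($N_t\in\mathbb N_+$) satisfy $$\theta:=bT\,\mathrm{Lip}(R)\,\zeta_{a,b,c}(h_t)<1 .$$ Then the map $\widehat F$ defined in the context has a unique root. Furthermore, set $\kappa=\overline\sigma/\underline\sigma$, where $\underline\sigma=\inf_U\sigma_{\min}(D\widehat F(U))$ and $\overline\sigma=\sup_U\sigma_{\max}(D\widehat F(U))$, and set $\epsilon=\kappa-\frac12$, $\gamma=\frac1\kappa-\frac1{2\kappa^2}$. Then every solution $(U_t,Q_t)_{t\ge0}$, with initial position $(U_0,Q_0)$, of the PDHG flow $$\dot Q=-\epsilon Q+\widehat F(U),\qquad\dot U=-D\widehat F(U)^\top\big((1-\gamma\epsilon)Q+\gamma\widehat F(U)\big)$$ satisfies, for all $t\ge0$, $$\|\widehat F(U_t)\|\le\exp\Big(-\frac5{32}\cdot\frac{(1-\theta)^3}{1+\theta}\,t\Big)\sqrt{\|\widehat F(U_0)\|^2+(1+\theta)\|Q_0\|^2}.$$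
   Context: Let $n=N_x^2$. Define $F:\mathbb R^{N_tn}\to\mathbb R^{N_tn}$ by $$F(U)=\mathscr DU+h_t\mathscr G_h(a\mathscr L_hU+bf(U))-V,$$ where $f$ acts entrywise, $\mathscr D=D_{N_t}\otimes I_n$ with $D_{N_t}$ the $N_t\times N_t$ matrix having $1$ on the diagonal, $-1$ on the first subdiagonal and $0$ elsewhere, $\mathscr G_h=I_{N_t}\otimes\mathcal G_h$, $\mathscr L_h=I_{N_t}\otimes\mathcal L_h$, and $V\in\mathbb R^{N_tn}$ is a constant vector. With $J_f=cI$, put $\mathscr M=\mathscr D+ah_t\mathscr G_h\mathscr L_h+bch_t\mathscr G_h$ (which is invertible) and $\widehat F(U)=\mathscr M^{-1}F(U)$. The remainder is $R(U)=f(U)-f(\overline U)-c(U-\overline U)$ for a fixed reference point $\overline U$; it acts entrywise as $u\mapsto f(u)-cu$ up to additive constants, and $\mathrm{Lip}(R)$ is the Lipschitz constant of $u\mapsto f(u)-cu$ on $\mathbb R$. Further, $$\zeta_{a,b,c}(h_t)=\max_{1\le k\le n}\frac{\lambda_k(\mathcal G_h)}{1+h_t\big(a\lambda_k(\mathcal G_h)\lambda_k(\mathcal L_h)+bc\lambda_k(\mathcal G_h)\big)},$$ where $\lambda_k(\mathcal G_h),\lambda_k(\mathcal L_h)$ are the eigenvalues of $\mathcal G_h,\mathcal L_h$ listed along a common orthonormal eigenbasis. $\|\cdot\|$ is the Euclidean norm; $\sigma_{\min},\sigma_{\max}$ are smallest and largest singular values; the infimum and supremum are over $U\in\mathbb R^{N_tn}$.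 *)

theory Defs
  imports "HOL-Analysis.Analysis"
begin

(* Conventions on sizes.  A finite type 'x with N_x elements and a finite linearly ordered type 't
   with N_t elements play the roles of {1..N_x} and {1..N_t}.  Spatial vectors live in
   R^(N_x^2) = real^('x * 'x), space-time vectors in R^(N_t n) = real^('t * ('x * 'x)), n = N_x^2. *)

definition kronecker :: "real^'a^'b \<Rightarrow> real^'c^'d \<Rightarrow> real^('a \<times> 'c)^('b \<times> 'd)" where
  "kronecker A B = (\<chi> i j. A $ fst i $ fst j * B $ snd i $ snd j)"

(* Position of i in the increasing enumeration of 't, counted from 0. *)
definition pos :: "'t::{finite,linorder} \<Rightarrow> nat" where
  "pos i = card {k. k < i}"

definition diff_matrix :: "real^('t::{finite,linorder})^('t::{finite,linorder})" where
  "diff_matrix = (\<chi> i j. if i = j then 1 else if pos i = pos j + 1 then - 1 else 0)"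

definition entrywise :: "(real \<Rightarrow> real) \<Rightarrow> real^'n \<Rightarrow> real^'n" where
  "entrywise f U = (\<chi> i. f (U $ i))"

definition D_op :: "real^('t \<times> ('x \<times> 'x))^('t::{finite,linorder} \<times> ('x::finite \<times> 'x))" where
  "D_op = kronecker diff_matrix (mat 1)"

definition lift_op :: "real^('x \<times> 'x)^('x \<times> 'x)
    \<Rightarrow> real^('t \<times> ('x \<times> 'x))^('t::{finite,linorder} \<times> ('x::finite \<times> 'x))" where
  "lift_op A = kronecker (mat 1) A"

definition F_map ::
  "real \<Rightarrow> real \<Rightarrow> real \<Rightarrow> (real \<Rightarrow> real) \<Rightarrow> real^('x \<times> 'x)^('x \<times> 'x) \<Rightarrow> real^('x \<times> 'x)^('x \<times> 'x)
    \<Rightarrow> real^('t \<times> ('x \<times> 'x)) \<Rightarrow> real^('t \<times> ('x \<times> 'x)) \<Rightarrow> real^('t::{finite,linorder} \<times> ('x::finite \<times> 'x))"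
  where
  "F_map a b h f G L V U =
     D_op *v U + h *\<^sub>R (lift_op G *v (a *\<^sub>R (lift_op L *v U) + b *\<^sub>R entrywise f U)) - V"

definition M_op ::
  "real \<Rightarrow> real \<Rightarrow> real \<Rightarrow> real \<Rightarrow> real^('x \<times> 'x)^('x \<times> 'x) \<Rightarrow> real^('x \<times> 'x)^('x \<times> 'x)
    \<Rightarrow> real^('t \<times> ('x \<times> 'x))^('t::{finite,linorder} \<times> ('x::finite \<times> 'x))" where
  "M_op a b c h G L =
     D_op + (a * h) *\<^sub>R (lift_op G ** lift_op L) + (b * c * h) *\<^sub>R lift_op G"

definition F_hat ::
  "real \<Rightarrow> real \<Rightarrow> real \<Rightarrow> real \<Rightarrow> (real \<Rightarrow> real) \<Rightarrow> real^('x \<times> 'x)^('x \<times> 'x) \<Rightarrow> real^('x \<times> 'x)^('x \<times> 'x)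
    \<Rightarrow> real^('t \<times> ('x \<times> 'x)) \<Rightarrow> real^('t \<times> ('x \<times> 'x)) \<Rightarrow> real^('t::{finite,linorder} \<times> ('x::finite \<times> 'x))"
  where
  "F_hat a b c h f G L V U = matrix_inv (M_op a b c h G L) *v F_map a b h f G L V U"

definition self_adjoint :: "real^'n^'n \<Rightarrow> bool" where
  "self_adjoint A \<longleftrightarrow> transpose A = A"

definition nonneg_definite :: "real^'n^'n \<Rightarrow> bool" where
  "nonneg_definite A \<longleftrightarrow> (\<forall>v. 0 \<le> v \<bullet> (A *v v))"

(* The family v is indexed by the full index type, so orthonormality makes it a basis. *)
definition common_eigenbasis ::
  "real^'n^'n \<Rightarrow> real^'n^'n \<Rightarrow> ('n \<Rightarrow> real^'n) \<Rightarrow> ('n \<Rightarrow> real) \<Rightarrow> ('n \<Rightarrow> real) \<Rightarrow> bool" where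
  "common_eigenbasis A B v \<alpha> \<beta> \<longleftrightarrow>
     (\<forall>k l. v k \<bullet> v l = (if k = l then 1 else 0)) \<and>
     (\<forall>k. A *v v k = \<alpha> k *\<^sub>R v k) \<and> (\<forall>k. B *v v k = \<beta> k *\<^sub>R v k)"

(* For commuting self-adjoint G and L a common orthonormal eigenbasis exists, and the set of pairs
   (\<alpha> k, \<beta> k) is the same for all of them, so the choice does not affect the value. *)
definition zeta ::
  "real \<Rightarrow> real \<Rightarrow> real \<Rightarrow> real^'n^'n \<Rightarrow> real^'n^'n \<Rightarrow> real \<Rightarrow> real" where
  "zeta a b c G L h = (SOME z. \<exists>v \<alpha> \<beta>. common_eigenbasis G L v \<alpha> \<beta> \<and>
     z = Max (range (\<lambda>k. \<alpha> k / (1 + h * (a * \<alpha> k * \<beta> k + b * c * \<alpha> k)))))"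

(* Least Lipschitz constant on the real line. *)
definition Lip :: "(real \<Rightarrow> real) \<Rightarrow> real" where
  "Lip g = Inf {C. C-lipschitz_on UNIV g}"

(* Singular values as nonnegative square roots of the eigenvalues of A\<^sup>T A. *)
definition singular_values :: "real^'n^'n \<Rightarrow> real set" where
  "singular_values A =
     {s. 0 \<le> s \<and> (\<exists>v. v \<noteq> 0 \<and> (transpose A ** A) *v v = s\<^sup>2 *\<^sub>R v)}"

definition sigma_min :: "real^'n^'n \<Rightarrow> real" where
  "sigma_min A = Min (singular_values A)"

definition sigma_max :: "real^'n^'n \<Rightarrow> real" where
  "sigma_max A = Max (singular_values A)"

definition pdhg_solution ::
  "real \<Rightarrow> real \<Rightarrow> (real^'n \<Rightarrow> real^'n) \<Rightarrow> (real \<Rightarrow> real^'n) \<Rightarrow> (real \<Rightarrow> real^'n) \<Rightarrow> bool" where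
  "pdhg_solution \<epsilon> \<gamma> \<Phi> U Q \<longleftrightarrow> (\<forall>t\<ge>0.
     (Q has_vector_derivative (- \<epsilon> *\<^sub>R Q t + \<Phi> (U t))) (at t within {0..}) \<and>
     (U has_vector_derivative
        - (transpose (jacobian \<Phi> (at (U t))) *v ((1 - \<gamma> * \<epsilon>) *\<^sub>R Q t + \<gamma> *\<^sub>R \<Phi> (U t))))
       (at t within {0..}))"

end

theory Submission
  imports Defs
begin

text \<open>
  The preconditioned map is \<open>\<Phi> = id + W\<close> up to a constant, where \<open>W = b h M\<^sup>-\<^sup>1 G R\<close>. In a common
  eigenbasis of \<open>G\<close> and \<open>L\<close>, forward substitution through the bidiagonal time matrix
  gives \<open>\<parallel>h M\<^sup>-\<^sup>1 G\<parallel> \<le> T \<zeta>\<close>, so \<open>W\<close> is \<open>\<theta>\<close>-Lipschitz. Banach's fixed point theorem yields the root,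
  and the singular values of every Jacobian \<open>J\<close> lie in \<open>[1 - \<theta>, 1 + \<theta>]\<close>.

  Along the flow, \<open>x = \<Phi>(U)\<close> satisfies \<open>x' = - J J\<^sup>T ((1 - \<gamma>\<epsilon>) Q + \<gamma> x)\<close>. The Lyapunov function
  \<open>\<parallel>x\<parallel>\<^sup>2 + (\<sigma>lo\<^sup>2 / 2) \<parallel>Q\<parallel>\<^sup>2\<close> decays at twice the claimed rate: in an eigenbasis of \<open>J J\<^sup>T\<close> this is a family
  of binary quadratic forms indexed by the eigenvalue \<open>p \<in> [\<sigma>lo\<^sup>2, \<sigma>hi\<^sup>2]\<close>, whose discriminant is convex
  in \<open>p\<close> and hence only needs to be checked at the two endpoints. The weight satisfies
  \<open>\<sigma>lo\<^sup>2 / 2 \<le> 1 + \<theta>\<close> because \<open>\<sigma>lo \<le> 1 + \<theta> < 2\<close>.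
\<close>

section \<open>Simultaneous diagonalisation of commuting self-adjoint matrices\<close>

lemma self_adjoint_inner:
  fixes A :: "real^'n^'n"
  assumes "self_adjoint A"
  shows "(A *v x) \<bullet> y = x \<bullet> (A *v y)"
  by (metis assms dot_lmul_matrix self_adjoint_def transpose_matrix_vector)

lemma inner_transpose_matrix:
  fixes A :: "real^'n^'n"
  shows "(transpose A *v x) \<bullet> y = x \<bullet> (A *v y)"
  by (simp add: dot_lmul_matrix)

text \<open>A maximiser of the Rayleigh quotient on an invariant subspace is an eigenvector.\<close>

lemma self_adjoint_eigenvector_in_subspace:
  fixes A :: "real^'n^'n"
  assumes A: "self_adjoint A" and S: "subspace S" and ne: "\<exists>x\<in>S. x \<noteq> 0"
    and inv: "\<And>x. x \<in> S \<Longrightarrow> A *v x \<in> S"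
  obtains v l where "v \<in> S" "norm v = 1" "A *v v = l *\<^sub>R v"
proof -
  let ?K = "sphere 0 1 \<inter> S"
  have "compact ?K"
    by (simp add: S closed_subspace compact_Int_closed)
  moreover have "?K \<noteq> {}"
  proof -
    from ne obtain x where x: "x \<in> S" "x \<noteq> 0" by blast
    then have "(1 / norm x) *\<^sub>R x \<in> ?K"
      using S by (simp add: subspace_scale)
    then show ?thesis by blast
  qed
  moreover have "continuous_on ?K (\<lambda>x. x \<bullet> (A *v x))"
    by (intro continuous_intros linear_continuous_on matrix_vector_mul_bounded_linear)
  ultimately obtain v where v: "v \<in> ?K" and vmax: "\<And>x. x \<in> ?K \<Longrightarrow> x \<bullet> (A *v x) \<le> v \<bullet> (A *v v)"
    using continuous_attains_sup by (metis (mono_tags, lifting))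
  define l where "l = v \<bullet> (A *v v)"
  \<comment> \<open>\<open>B\<close> is the quadratic form of \<open>l I - A\<close>. Maximality of
    \<open>l\<close> makes it nonnegative on \<open>S\<close>, and it vanishes at \<open>v\<close>,
    so \<open>v\<close> minimises it there.\<close>
  define B where "B x = l * (x \<bullet> x) - x \<bullet> (A *v x)" for x
  have vS: "v \<in> S" and nv: "norm v = 1" and vv: "v \<bullet> v = 1"
    using v by (auto simp: norm_eq_1)
  have B0: "0 \<le> B x" if "x \<in> S" for x
  proof (cases "x = 0")
    case False
    have "(1 / norm x) *\<^sub>R x \<in> ?K"
      using S that False by (simp add: subspace_scale)
    from vmax[OF this] have "(x \<bullet> (A *v x)) / (norm x)\<^sup>2 \<le> l"
      by (simp add: l_def matrix_vector_mult_scaleR power2_eq_square)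
    then show ?thesis
      using False by (simp add: B_def power2_norm_eq_inner field_simps)
  qed (simp add: B_def)
  \<comment> \<open>The residual \<open>w\<close> is the descent direction: moving from
    \<open>v\<close> to \<open>v - t w\<close> changes \<open>B\<close> by
    \<open>- 2 t (w \<bullet> w)\<close> to first order, which forces \<open>w = 0\<close>.\<close>
  define w where "w = l *\<^sub>R v - A *v v"
  have wS: "w \<in> S"
    unfolding w_def using S vS inv by (simp add: subspace_diff subspace_scale)
  have expand: "B (v - t *\<^sub>R w) = - 2 * t * (w \<bullet> w) + t\<^sup>2 * B w" for t
  proof -
    have "B (v - t *\<^sub>R w) = B v - 2 * t * (l * (w \<bullet> v) - w \<bullet> (A *v v)) + t\<^sup>2 * B w"
      using self_adjoint_inner[OF A, of v w]
      by (simp add: B_def algebra_simps power2_eq_square inner_commute)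
    moreover have "B v = 0"
      by (simp add: B_def l_def vv)
    moreover have "l * (w \<bullet> v) - w \<bullet> (A *v v) = w \<bullet> w"
      by (simp add: w_def algebra_simps)
    ultimately show ?thesis by simp
  qed
  have "w \<bullet> w \<le> 0"
  proof (rule ccontr)
    assume "\<not> w \<bullet> w \<le> 0"
    then have ww: "w \<bullet> w > 0" by linarith
    \<comment> \<open>With this \<open>t\<close> the second-order term \<open>t * B w\<close> stays
      below \<open>w \<bullet> w\<close>, so it cannot compensate the first-order loss. The summand
      1 keeps the denominator positive when \<open>B w = 0\<close>.\<close>
    define t where "t = (w \<bullet> w) / (1 + B w)"
    have Bw: "0 \<le> B w" using B0 wS by blast
    have t: "t > 0" unfolding t_def using ww Bw by simp
    have "v - t *\<^sub>R w \<in> S"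
      using S vS wS by (simp add: subspace_diff subspace_scale)
    from B0[OF this] have "0 \<le> t * (t * B w - 2 * (w \<bullet> w))"
      unfolding expand by (simp add: algebra_simps power2_eq_square)
    then have "2 * (w \<bullet> w) \<le> t * B w"
      using t by (simp add: zero_le_mult_iff)
    moreover have "t * B w \<le> w \<bullet> w"
      unfolding t_def using ww Bw by (simp add: divide_simps)
    ultimately show False using ww by linarith
  qed
  then have "w = 0" using inner_gt_zero_iff[of w] by (simp only: not_le[symmetric]) blast
  then have "A *v v = l *\<^sub>R v" by (simp add: w_def)
  then show thesis using that vS nv by blast
qed

text \<open>An eigenspace of \<open>A\<close> within \<open>S\<close> is mapped to itself by
  \<open>B\<close> because the two matrices commute; an eigenvector of \<open>B\<close> inside that
  eigenspace serves both.\<close>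

lemma commuting_common_eigenvector:
  fixes A B :: "real^'n^'n"
  assumes A: "self_adjoint A" and B: "self_adjoint B" and AB: "A ** B = B ** A"
    and S: "subspace S" and ne: "\<exists>x\<in>S. x \<noteq> 0"
    and invA: "\<And>x. x \<in> S \<Longrightarrow> A *v x \<in> S" and invB: "\<And>x. x \<in> S \<Longrightarrow> B *v x \<in> S"
  obtains v l m where "v \<in> S" "norm v = 1" "A *v v = l *\<^sub>R v" "B *v v = m *\<^sub>R v"
proof -
  obtain u l where u: "u \<in> S" "norm u = 1" "A *v u = l *\<^sub>R u"
    using self_adjoint_eigenvector_in_subspace[OF A S ne invA] by blast
  define S' where "S' = {x \<in> S. A *v x = l *\<^sub>R x}"
  have "subspace S'"
    using S by (auto simp: subspace_def S'_def algebra_simps)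
  moreover have "\<exists>x\<in>S'. x \<noteq> 0"
    using u by (auto simp: S'_def intro!: bexI[of _ u])
  moreover have "B *v x \<in> S'" if "x \<in> S'" for x
  proof -
    have "A *v (B *v x) = B *v (A *v x)"
      by (simp add: matrix_vector_mul_assoc AB)
    then show ?thesis
      using that invB by (simp add: S'_def matrix_vector_mult_scaleR)
  qed
  ultimately obtain v m where "v \<in> S'" "norm v = 1" "B *v v = m *\<^sub>R v"
    using self_adjoint_eigenvector_in_subspace[OF B] by blast
  then show thesis using that by (auto simp: S'_def)
qed

text \<open>Take an orthonormal set of joint eigenvectors of maximal cardinality. Its orthogonal
  complement is invariant under both matrices, so a nonzero vector there would yield a further joint
  eigenvector.\<close>

lemma commuting_common_eigenbasis:
  fixes A B :: "real^'n^'n"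
  assumes A: "self_adjoint A" and B: "self_adjoint B" and AB: "A ** B = B ** A"
  obtains v \<alpha> \<beta> where "common_eigenbasis A B v \<alpha> \<beta>"
proof -
  define P where "P W \<longleftrightarrow> pairwise orthogonal W \<and>
    (\<forall>w\<in>W. norm w = 1 \<and> (\<exists>l. A *v w = l *\<^sub>R w) \<and> (\<exists>m. B *v w = m *\<^sub>R w))" for W
  have P_indep: "independent W" if "P W" for W
    using that unfolding P_def by (intro pairwise_orthogonal_independent) auto
  have P_bound: "card W \<le> CARD('n) \<and> finite W" if "P W" for W
    using independent_bound[OF P_indep[OF that]] by simp
  have "P {}" by (simp add: P_def)
  moreover have "\<forall>W. P W \<longrightarrow> card W < Suc CARD('n)"
    using P_bound by (simp add: less_Suc_eq_le)
  ultimately obtain W where W: "P W" and Wmax: "\<And>W'. P W' \<Longrightarrow> card W' \<le> card W"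
    using ex_has_greatest_nat[of P "{}" card "Suc CARD('n)"] by blast
  have finW: "finite W" using P_bound W by blast
  define S where "S = {x. \<forall>w\<in>W. orthogonal x w}"
  have "subspace S"
    unfolding S_def using subspace_orthogonal_to_vectors[of W]
    by (simp add: orthogonal_commute)
  have invS: "C *v x \<in> S" if C: "self_adjoint C" and ev: "\<forall>w\<in>W. \<exists>l. C *v w = l *\<^sub>R w" and "x \<in> S" for C x
    unfolding S_def
  proof clarify
    fix w assume w: "w \<in> W"
    then obtain l where "C *v w = l *\<^sub>R w" using ev by blast
    moreover have "x \<bullet> w = 0" using \<open>x \<in> S\<close> w by (simp add: S_def orthogonal_def)
    ultimately show "orthogonal (C *v x) w"
      by (simp add: orthogonal_def self_adjoint_inner[OF C])
  qed
  have "x = 0" if "x \<in> S" for x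
  proof (rule ccontr)
    assume "x \<noteq> 0"
    then have "\<exists>x\<in>S. x \<noteq> 0" using that by blast
    moreover have "\<And>x. x \<in> S \<Longrightarrow> A *v x \<in> S" "\<And>x. x \<in> S \<Longrightarrow> B *v x \<in> S"
      using W unfolding P_def by (auto intro!: invS A B)
    ultimately obtain v l m where v: "v \<in> S" "norm v = 1" "A *v v = l *\<^sub>R v" "B *v v = m *\<^sub>R v"
      using commuting_common_eigenvector[OF A B AB \<open>subspace S\<close>] by blast
    have "v \<notin> W"
      using v unfolding S_def by (auto simp: orthogonal_self)
    have "P (insert v W)"
      using W v unfolding P_def S_def
      by (auto simp: pairwise_insert orthogonal_commute)
    from Wmax[OF this] show False
      using \<open>v \<notin> W\<close> finW by simp
  qed
  note S0 = this
  have "span W = UNIV"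
  proof (rule ccontr)
    assume "span W \<noteq> UNIV"
    from span_not_UNIV_orthogonal[OF this] obtain x
      where x: "x \<noteq> 0" "\<forall>y\<in>span W. x \<bullet> y = 0" by blast
    then have "x \<in> S" by (simp add: S_def orthogonal_def span_base)
    then show False using S0 x by blast
  qed
  then have cardW: "card W = CARD('n)"
    using dim_span_eq_card_independent[OF P_indep[OF W]] by simp
  \<comment> \<open>\<open>common_eigenbasis\<close> asks for a family over the index type, so the
    set \<open>W\<close> is enumerated by \<open>'n\<close>.\<close>
  then obtain v where v: "bij_betw v (UNIV :: 'n set) W"
    using finite_same_card_bij[of "UNIV :: 'n set" W] finW by auto
  then have vW: "v k \<in> W" for k by (auto simp: bij_betw_def)
  have "\<forall>k. \<exists>l. A *v v k = l *\<^sub>R v k" "\<forall>k. \<exists>m. B *v v k = m *\<^sub>R v k"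
    using W vW unfolding P_def by blast+
  then obtain \<alpha> \<beta> where "\<forall>k. A *v v k = \<alpha> k *\<^sub>R v k" "\<forall>k. B *v v k = \<beta> k *\<^sub>R v k"
    using choice[of "\<lambda>k l. A *v v k = l *\<^sub>R v k"] choice[of "\<lambda>k l. B *v v k = l *\<^sub>R v k"] by blast
  moreover have "v k \<bullet> v l = (if k = l then 1 else 0)" for k l
  proof (cases "k = l")
    case True
    then show ?thesis using W vW[of l] unfolding P_def by (simp add: norm_eq_1)
  next
    case False
    then have "v k \<noteq> v l" using v by (auto simp: bij_betw_def inj_def)
    then show ?thesis using W vW False unfolding P_def
      by (meson orthogonal_def pairwise_def)
  qed
  ultimately have "common_eigenbasis A B v \<alpha> \<beta>" unfolding common_eigenbasis_def by blast
  then show thesis by (rule that)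
qed

text \<open>Orthonormal vectors indexed by all of \<open>'n\<close> span the space; what remains of
  \<open>x\<close> after subtracting its expansion is orthogonal to each of them, hence to
  itself.\<close>

lemma orthonormal_family_expand:
  fixes v :: "'n::finite \<Rightarrow> real^'n"
  assumes v: "\<forall>k l. v k \<bullet> v l = (if k = l then 1 else 0)"
  shows "x = (\<Sum>k\<in>UNIV. (x \<bullet> v k) *\<^sub>R v k)"
proof -
  have inj: "inj v" using v by (metis injI zero_neq_one)
  have "independent (range v)"
    using v by (intro pairwise_orthogonal_independent)
      (auto simp: pairwise_def orthogonal_def, metis inner_zero_left zero_neq_one)
  moreover have "card (range v) = DIM(real^'n)"
    by (simp add: card_image inj)
  ultimately have span: "span (range v) = UNIV"
    by (metis card_eq_dim dim_UNIV finite_imageI finite top_greatest UNIV_I subset_antisym subsetI subset_UNIV)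
  define y where "y = x - (\<Sum>k\<in>UNIV. (x \<bullet> v k) *\<^sub>R v k)"
  have "y \<bullet> v l = 0" for l
    by (simp add: y_def inner_diff_left inner_sum_left v[rule_format] if_distrib cong: if_cong)
  then have "orthogonal y y"
    by (intro orthogonal_to_span[of y "range v"]) (auto simp: span orthogonal_def)
  then show ?thesis by (simp add: y_def orthogonal_self)
qed

lemma orthonormal_family_inner:
  fixes v :: "'n::finite \<Rightarrow> real^'n"
  assumes v: "\<forall>k l. v k \<bullet> v l = (if k = l then 1 else 0)"
  shows "x \<bullet> y = (\<Sum>k\<in>UNIV. (x \<bullet> v k) * (y \<bullet> v k))"
proof -
  have "x \<bullet> y = (\<Sum>k\<in>UNIV. (x \<bullet> v k) *\<^sub>R v k) \<bullet> y"
    by (subst (1) orthonormal_family_expand[OF v, of x]) (rule refl)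
  also have "\<dots> = (\<Sum>k\<in>UNIV. (x \<bullet> v k) * (v k \<bullet> y))"
    by (simp add: inner_sum_left)
  also have "\<dots> = (\<Sum>k\<in>UNIV. (x \<bullet> v k) * (y \<bullet> v k))"
    by (simp add: inner_commute)
  finally show ?thesis .
qed

lemma orthonormal_family_norm:
  fixes v :: "'n::finite \<Rightarrow> real^'n"
  assumes v: "\<forall>k l. v k \<bullet> v l = (if k = l then 1 else 0)"
  shows "norm x = L2_set (\<lambda>k. x \<bullet> v k) UNIV"
  unfolding L2_set_def norm_eq_sqrt_inner
  by (subst orthonormal_family_inner[OF v]) (simp add: power2_eq_square)

section \<open>The preconditioned implicit scheme\<close>

text \<open>Resolves the Hilbert choice in \<open>zeta\<close>: since a common eigenbasis exists,
  the chosen value is the maximum over some such basis, and later estimates are made in exactly that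
  basis.\<close>

lemma zeta_eigenbasis:
  fixes G L :: "real^'n^'n"
  assumes "self_adjoint G" "self_adjoint L" "G ** L = L ** G"
  obtains v \<alpha> \<beta> where "common_eigenbasis G L v \<alpha> \<beta>"
    and "zeta a b c G L h = Max (range (\<lambda>k. \<alpha> k / (1 + h * (a * \<alpha> k * \<beta> k + b * c * \<alpha> k))))"
proof -
  have "\<exists>z v \<alpha> \<beta>. common_eigenbasis G L v \<alpha> \<beta> \<and>
     z = Max (range (\<lambda>k. \<alpha> k / (1 + h * (a * \<alpha> k * \<beta> k + b * c * \<alpha> k))))"
    using commuting_common_eigenbasis[OF assms] by metis
  from someI_ex[OF this] show thesis
    using that unfolding zeta_def by blast
qed

lemma nonneg_definite_eigenvalue:
  fixes A :: "real^'n^'n"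
  assumes "nonneg_definite A" "A *v v = l *\<^sub>R v" "v \<bullet> v = 1"
  shows "0 \<le> l"
  using assms by (metis inner_scaleR_right mult.right_neutral nonneg_definite_def)

lemma L2_set_abs: "L2_set (\<lambda>k. \<bar>f k\<bar>) K = L2_set f K"
  by (simp add: L2_set_def)

text \<open>One implicit time step: \<open>y = (I + K)\<^sup>-\<^sup>1 (p + G w)\<close> with \<open>K = a h G L + b c h G\<close>.\<close>

lemma implicit_step_bound:
  fixes G L :: "real^'n^'n"
  assumes nonneg: "a \<ge> 0" "b \<ge> 0" "c \<ge> 0" "h \<ge> 0"
    and G: "self_adjoint G" "nonneg_definite G"
    and L: "self_adjoint L" "nonneg_definite L" and comm: "G ** L = L ** G"
    and step: "y + (a * h) *\<^sub>R (G *v (L *v y)) + (b * c * h) *\<^sub>R (G *v y) = p + G *v w"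
  shows "norm y \<le> norm p + zeta a b c G L h * norm w" and "0 \<le> zeta a b c G L h"
proof -
  obtain v \<alpha> \<beta> where ev: "common_eigenbasis G L v \<alpha> \<beta>"
    and zeta: "zeta a b c G L h = Max (range (\<lambda>k. \<alpha> k / (1 + h * (a * \<alpha> k * \<beta> k + b * c * \<alpha> k))))"
    using zeta_eigenbasis[OF G(1) L(1) comm] .
  have orth: "\<forall>k l. v k \<bullet> v l = (if k = l then 1 else 0)"
    and Gv: "G *v v k = \<alpha> k *\<^sub>R v k" and Lv: "L *v v k = \<beta> k *\<^sub>R v k" for k
    using ev by (auto simp: common_eigenbasis_def)
  have \<alpha>: "0 \<le> \<alpha> k" and \<beta>: "0 \<le> \<beta> k" for k
    using nonneg_definite_eigenvalue[OF G(2) Gv] nonneg_definite_eigenvalue[OF L(2) Lv] orth by auto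
  \<comment> \<open>\<open>m k\<close> is the eigenvalue of \<open>K\<close> at
    \<open>v k\<close>.\<close>
  define m where "m k = h * (a * \<alpha> k * \<beta> k + b * c * \<alpha> k)" for k
  have m: "0 \<le> m k" for k
    unfolding m_def using nonneg \<alpha> \<beta> by simp
  define z where "z = zeta a b c G L h"
  have z: "\<alpha> k / (1 + m k) \<le> z" for k
    unfolding z_def zeta m_def by (rule Max_ge) auto
  have "0 \<le> \<alpha> k / (1 + m k)" for k
    using \<alpha>[of k] m[of k] by simp
  then have z0: "0 \<le> z"
    using z order_trans by blast
  then show "0 \<le> zeta a b c G L h" by (simp add: z_def)
  \<comment> \<open>In coordinates the step reads \<open>(1 + m) y = p + \<alpha> w\<close>. Since
    \<open>1 / (1 + m) \<le> 1\<close> and \<open>\<alpha> / (1 + m) \<le> z\<close>, the previous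
    value is not amplified and the source gains at most the factor \<open>z\<close>.\<close>
  have coord: "\<bar>y \<bullet> v k\<bar> \<le> \<bar>p \<bullet> v k\<bar> + z * \<bar>w \<bullet> v k\<bar>" for k
  proof -
    have Gx: "(G *v x) \<bullet> v k = \<alpha> k * (x \<bullet> v k)" and Lx: "(L *v x) \<bullet> v k = \<beta> k * (x \<bullet> v k)" for x
      by (simp_all add: self_adjoint_inner[OF G(1)] self_adjoint_inner[OF L(1)] Gv Lv)
    have "(y + (a * h) *\<^sub>R (G *v (L *v y)) + (b * c * h) *\<^sub>R (G *v y)) \<bullet> v k = (p + G *v w) \<bullet> v k"
      by (simp only: step)
    then have "(1 + m k) * (y \<bullet> v k) = p \<bullet> v k + \<alpha> k * (w \<bullet> v k)"
      by (simp add: inner_add_left Gx Lx m_def algebra_simps)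
    then have "y \<bullet> v k = (p \<bullet> v k) / (1 + m k) + \<alpha> k / (1 + m k) * (w \<bullet> v k)"
      using m[of k] by (simp add: nonzero_eq_divide_eq add_divide_distrib[symmetric] mult.commute)
    then have "\<bar>y \<bullet> v k\<bar> \<le> \<bar>(p \<bullet> v k) / (1 + m k)\<bar> + \<bar>\<alpha> k / (1 + m k) * (w \<bullet> v k)\<bar>"
      by (metis abs_triangle_ineq)
    also have "\<bar>(p \<bullet> v k) / (1 + m k)\<bar> \<le> \<bar>p \<bullet> v k\<bar>"
      using m[of k] by (simp add: abs_divide divide_le_eq mult_left_le_one_le mult_le_cancel_left1)
    also have "\<bar>\<alpha> k / (1 + m k) * (w \<bullet> v k)\<bar> \<le> z * \<bar>w \<bullet> v k\<bar>"
      unfolding abs_mult abs_of_nonneg[OF \<open>0 \<le> \<alpha> k / (1 + m k)\<close>]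
      by (rule mult_right_mono[OF z]) simp
    finally show ?thesis by simp
  qed
  have "norm y = L2_set (\<lambda>k. \<bar>y \<bullet> v k\<bar>) UNIV"
    by (simp add: orthonormal_family_norm[OF orth] L2_set_abs)
  also have "\<dots> \<le> L2_set (\<lambda>k. \<bar>p \<bullet> v k\<bar> + z * \<bar>w \<bullet> v k\<bar>) UNIV"
    using coord by (intro L2_set_mono) auto
  also have "\<dots> \<le> L2_set (\<lambda>k. \<bar>p \<bullet> v k\<bar>) UNIV + L2_set (\<lambda>k. z * \<bar>w \<bullet> v k\<bar>) UNIV"
    by (rule L2_set_triangle_ineq)
  also have "\<dots> = norm p + z * norm w"
    by (simp add: orthonormal_family_norm[OF orth] L2_set_abs L2_set_right_distrib[OF z0, symmetric])
  finally show "norm y \<le> norm p + zeta a b c G L h * norm w" by (simp add: z_def)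
qed

section \<open>Forward substitution through the time slices\<close>

definition slice :: "real^('t::finite \<times> 'n) \<Rightarrow> 't \<Rightarrow> real^'n" where
  "slice y t = (\<chi> i. y $ (t, i))"

lemma slice_add: "slice (x + y) t = slice x t + slice y t"
  and slice_scaleR: "slice (r *\<^sub>R x) t = r *\<^sub>R slice x t"
  by (simp_all add: slice_def vec_eq_iff)

lemma norm_slice: "norm (y :: real^('t::finite \<times> 'n::finite)) = L2_set (\<lambda>t. norm (slice y t)) UNIV"
  by (simp add: norm_vec_def slice_def L2_set_def sum_nonneg sum.cartesian_product UNIV_Times_UNIV
      case_prod_unfold)

lemma slice_kronecker:
  fixes A :: "real^'n^'m" and B :: "real^'t^'s"
  shows "slice (kronecker B A *v y) s = (\<Sum>t\<in>UNIV. B $ s $ t *\<^sub>R (A *v slice y t))"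
  by (simp add: slice_def kronecker_def vec_eq_iff matrix_vector_mult_def sum_distrib_left
      sum.cartesian_product UNIV_Times_UNIV case_prod_unfold mult.assoc)

lemma slice_lift_op: "slice (lift_op A *v y) t = A *v slice y t"
proof -
  have "slice (lift_op A *v y) t = (\<Sum>s\<in>UNIV. if t = s then A *v slice y s else 0)"
    unfolding lift_op_def slice_kronecker by (intro sum.cong) (auto simp: mat_def)
  then show ?thesis by simp
qed

lemma pos_less: "i < j \<Longrightarrow> pos i < pos j"
  unfolding pos_def by (rule psubset_card_mono) auto

lemma pos_eq_iff: "pos i = pos j \<longleftrightarrow> i = j"
  by (metis less_irrefl linorder_cases pos_less)

text \<open>Each row of the bidiagonal time matrix couples a slice to its predecessor only; the
  second alternative covers the first time index, which has none.\<close>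

lemma slice_D_op:
  fixes t :: "'t::{finite,linorder}" and y :: "real^('t \<times> ('x::finite \<times> 'x))"
  shows "(\<exists>j. pos t = pos j + 1 \<and> j < t \<and> slice (D_op *v y) t = slice y t - slice y j)
    \<or> slice (D_op *v y) t = slice y t"
proof -
  have D: "slice (D_op *v y) t = (\<Sum>s\<in>UNIV. diff_matrix $ t $ s *\<^sub>R slice y s)"
    by (simp add: D_op_def slice_kronecker)
  show ?thesis
  proof (cases "\<exists>j::'t. pos t = pos j + 1")
    case True
    then obtain j :: 't where j: "pos t = pos j + 1" by blast
    have "j < t"
      by (metis add.commute j less_add_one linorder_neqE not_less_iff_gr_or_eq pos_less)
    have "slice (D_op *v y) t =
        (\<Sum>s\<in>UNIV. (if t = s then slice y s else 0) - (if j = s then slice y s else 0))"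
      unfolding D using j \<open>j < t\<close> by (intro sum.cong) (auto simp: diff_matrix_def pos_eq_iff)
    also have "\<dots> = slice y t - slice y j"
      by (simp add: sum_subtractf)
    finally show ?thesis using j \<open>j < t\<close> by blast
  next
    case False
    then have "slice (D_op *v y) t = (\<Sum>s\<in>UNIV. if t = s then slice y s else 0)"
      unfolding D by (intro sum.cong) (auto simp: diff_matrix_def)
    then show ?thesis by simp
  qed
qed

lemma slice_M_op:
  "slice (M_op a b c h G L *v y) t = slice (D_op *v y) t
    + (a * h) *\<^sub>R (G *v (L *v slice y t)) + (b * c * h) *\<^sub>R (G *v slice y t)"
  by (simp add: M_op_def matrix_vector_mult_add_rdistrib scaleR_matrix_vector_assoc[symmetric]
      matrix_vector_mul_assoc[symmetric] slice_add slice_scaleR slice_lift_op)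

text \<open>Solving with \<open>M_op\<close> is implicit time stepping, so the bounds for single
  steps add up along time. One factor of the square root of \<open>CARD('t)\<close> comes from
  Cauchy-Schwarz on the sources, the other from collecting the slices of \<open>y\<close>.\<close>

lemma M_op_bound:
  fixes y w :: "real^('t::{finite,linorder} \<times> ('x::finite \<times> 'x))"
  assumes nonneg: "a \<ge> 0" "b \<ge> 0" "c \<ge> 0" "h \<ge> 0"
    and G: "self_adjoint G" "nonneg_definite G"
    and L: "self_adjoint L" "nonneg_definite L" and comm: "G ** L = L ** G"
    and M: "M_op a b c h G L *v y = lift_op G *v w"
  shows "norm y \<le> real CARD('t) * zeta a b c G L h * norm w"
proof -
  note step = implicit_step_bound[OF nonneg G L comm]
  define z where "z = zeta a b c G L h"
  \<comment> \<open>The step equation with all vectors zero holds trivially, and its second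
    conclusion gives \<open>0 \<le> z\<close>.\<close>
  have z0: "0 \<le> z"
    unfolding z_def by (rule step(2)[of 0 0 0]) simp
  have slice_le: "norm (slice y t) \<le> z * (\<Sum>s | s \<le> t. norm (slice w s))" for t
  proof (induction t rule: measure_induct_rule[of pos])
    case (less t)
    define K where "K = (a * h) *\<^sub>R (G *v (L *v slice y t)) + (b * c * h) *\<^sub>R (G *v slice y t)"
    have eq: "slice (D_op *v y) t + K = G *v slice w t"
      using arg_cong[OF M, of "\<lambda>x. slice x t"]
      by (simp add: slice_M_op slice_lift_op K_def add.assoc)
    from slice_D_op[of t y] show ?case
    proof
      assume "\<exists>j. pos t = pos j + 1 \<and> j < t \<and> slice (D_op *v y) t = slice y t - slice y j"
      then obtain j where j: "pos t = pos j + 1" "j < t"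
        "slice (D_op *v y) t = slice y t - slice y j" by blast
      \<comment> \<open>The predecessor slice \<open>slice y j\<close> enters the implicit step in
        the role of \<open>p\<close>; at the first time index this role falls to
        \<open>0\<close>.\<close>
      have "norm (slice y t) \<le> norm (slice y j) + z * norm (slice w t)"
        unfolding z_def using eq j(3) by (intro step(1)) (simp add: K_def algebra_simps)
      also have "\<dots> \<le> z * (\<Sum>s | s \<le> j. norm (slice w s)) + z * norm (slice w t)"
        using less[of j] j by simp
      also have "\<dots> = z * (\<Sum>s\<in>insert t {s. s \<le> j}. norm (slice w s))"
        using j by (simp add: algebra_simps)
      also have "\<dots> \<le> z * (\<Sum>s | s \<le> t. norm (slice w s))"
        using j z0 by (intro mult_left_mono sum_mono2) auto
      finally show ?thesis .
    next
      assume "slice (D_op *v y) t = slice y t"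
      then have "norm (slice y t) \<le> norm (0 :: real^('x \<times> 'x)) + z * norm (slice w t)"
        unfolding z_def using eq by (intro step(1)) (simp add: K_def algebra_simps)
      also have "\<dots> = z * (\<Sum>s\<in>{t}. norm (slice w s))" by simp
      also have "\<dots> \<le> z * (\<Sum>s | s \<le> t. norm (slice w s))"
        using z0 by (intro mult_left_mono sum_mono2) auto
      finally show ?thesis .
    qed
  qed
  define X where "X = (\<Sum>s\<in>UNIV. norm (slice w s))"
  have X0: "0 \<le> X" unfolding X_def by (simp add: sum_nonneg)
  have le_X: "norm (slice y t) \<le> z * X" for t
    by (rule order_trans[OF slice_le]) (auto simp: X_def intro!: mult_left_mono sum_mono2 z0)
  have "X\<^sup>2 \<le> (\<Sum>s\<in>UNIV. (norm (slice w s))\<^sup>2) * real CARD('t)"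
    unfolding X_def by (rule sum_squared_le_sum_of_squares)
  then have X2: "X\<^sup>2 \<le> (norm w)\<^sup>2 * real CARD('t)"
    by (simp add: norm_slice[of w] L2_set_def sum_nonneg)
  have "(norm y)\<^sup>2 = (\<Sum>t\<in>UNIV. (norm (slice y t))\<^sup>2)"
    by (simp add: norm_slice[of y] L2_set_def sum_nonneg)
  also have "\<dots> \<le> (\<Sum>t::'t\<in>UNIV. (z * X)\<^sup>2)"
    by (intro sum_mono power_mono le_X) simp
  also have "\<dots> = real CARD('t) * z\<^sup>2 * X\<^sup>2"
    by (simp add: power_mult_distrib)
  also have "\<dots> \<le> real CARD('t) * z\<^sup>2 * ((norm w)\<^sup>2 * real CARD('t))"
    by (intro mult_left_mono X2) simp
  also have "\<dots> = (real CARD('t) * z * norm w)\<^sup>2"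
    by (simp add: power2_eq_square)
  finally show ?thesis
    unfolding z_def[symmetric] by (rule power2_le_imp_le) (simp add: z0)
qed

text \<open>The bound with source \<open>0\<close> shows that the kernel is trivial, which suffices
  for a square matrix.\<close>

lemma invertible_M_op:
  fixes M :: "real^('t::{finite,linorder} \<times> ('x::finite \<times> 'x))^('t \<times> ('x \<times> 'x))"
  assumes "a \<ge> 0" "b \<ge> 0" "c \<ge> 0" "h \<ge> 0"
    and "self_adjoint G" "nonneg_definite G"
    and "self_adjoint L" "nonneg_definite L" and "G ** L = L ** G"
    and M: "M = M_op a b c h G L"
  shows "invertible M"
proof -
  have "y = 0" if "M *v y = 0" for y
    using M_op_bound[OF assms(1-9), of y 0] that M by simp
  then have "inj ((*v) M)"
    by (metis (no_types) eq_iff_diff_eq_0 injI matrix_vector_mult_diff_distrib)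
  then show ?thesis
    by (simp add: invertible_left_inverse matrix_left_invertible_injective)
qed

section \<open>The preconditioned map as a perturbation of the identity\<close>

text \<open>The infimum in \<open>Lip\<close> is attained: every difference quotient is a lower
  bound of the set of admissible constants, hence at most the infimum.\<close>

lemma lipschitz_on_Lip:
  assumes "\<exists>C. C-lipschitz_on UNIV g"
  shows "(Lip g)-lipschitz_on UNIV g"
proof (rule lipschitz_onI)
  let ?K = "{C. C-lipschitz_on UNIV g}"
  have ne: "?K \<noteq> {}" using assms by blast
  show "0 \<le> Lip g"
    unfolding Lip_def by (rule cInf_greatest[OF ne]) (auto intro: lipschitz_on_nonneg)
  fix x y :: real
  show "dist (g x) (g y) \<le> Lip g * dist x y"
  proof (cases "x = y")
    case False
    have "dist (g x) (g y) / dist x y \<le> Lip g"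
      unfolding Lip_def
    proof (rule cInf_greatest[OF ne])
      fix C assume "C \<in> ?K"
      then show "dist (g x) (g y) / dist x y \<le> C"
        using False by (auto simp: pos_divide_le_eq dest: lipschitz_onD)
    qed
    then show ?thesis using False by (simp add: pos_divide_le_eq)
  qed simp
qed

lemma matrix_inv_cancel:
  fixes A :: "real^'n^'n"
  assumes "invertible A"
  shows "A *v (matrix_inv A *v x) = x" and "matrix_inv A *v (A *v x) = x"
proof -
  have "A ** matrix_inv A = mat 1 \<and> matrix_inv A ** A = mat 1"
    unfolding matrix_inv_def by (rule someI_ex) (use assms in \<open>simp add: invertible_def\<close>)
  then show "A *v (matrix_inv A *v x) = x" and "matrix_inv A *v (A *v x) = x"
    unfolding matrix_vector_mul_assoc by simp_all
qed

text \<open>Split \<open>f u\<close> as \<open>(f u - c * u) + c * u\<close>. The linear part turns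
  the remaining operators into \<open>M_op\<close>, which the preconditioner cancels to the
  identity.\<close>

lemma F_hat_eq:
  fixes V :: "real^('t::{finite,linorder} \<times> ('x::finite \<times> 'x))"
  assumes "invertible (M_op a b c h G L :: real^('t \<times> ('x \<times> 'x))^('t \<times> ('x \<times> 'x)))"
  shows "F_hat a b c h f G L V U = U + (b * h) *\<^sub>R (matrix_inv (M_op a b c h G L) *v
      (lift_op G *v entrywise (\<lambda>u. f u - c * u) U)) - matrix_inv (M_op a b c h G L) *v V"
proof -
  let ?M = "M_op a b c h G L :: real^('t \<times> ('x \<times> 'x))^('t \<times> ('x \<times> 'x))"
  let ?R = "entrywise (\<lambda>u. f u - c * u) U"
  have R: "entrywise f U = ?R + c *\<^sub>R U"
    by (simp add: entrywise_def vec_eq_iff)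
  have "F_map a b h f G L V U = ?M *v U + (b * h) *\<^sub>R (lift_op G *v ?R) - V"
    unfolding F_map_def R
    by (simp add: M_op_def matrix_vector_mult_add_rdistrib scaleR_matrix_vector_assoc[symmetric]
        matrix_vector_mul_assoc[symmetric] matrix_vector_right_distrib matrix_vector_mult_scaleR
        scaleR_add_right mult_ac)
  moreover have "matrix_inv ?M *v (?M *v U) = U"
    using assms by (rule matrix_inv_cancel)
  ultimately show ?thesis
    by (simp add: F_hat_def matrix_vector_right_distrib matrix_vector_mult_diff_distrib
        matrix_vector_mult_scaleR)
qed

text \<open>The constant term drops out of the difference. The bound on solutions contributes
  \<open>CARD('t)\<close> and \<open>zeta\<close>, the entrywise remainder contributes
  \<open>Lip\<close>, and with the prefactor \<open>b * h\<close> the product is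
  \<open>\<theta>\<close>.\<close>

lemma F_hat_perturbation:
  fixes V :: "real^('t::{finite,linorder} \<times> ('x::finite \<times> 'x))" and f :: "real \<Rightarrow> real"
  assumes nonneg: "a \<ge> 0" "b \<ge> 0" "c \<ge> 0" "h \<ge> 0"
    and G: "self_adjoint G" "nonneg_definite G"
    and L: "self_adjoint L" "nonneg_definite L" and comm: "G ** L = L ** G"
    and f: "\<exists>C. C-lipschitz_on UNIV f"
    and Phi: "\<Phi> = F_hat a b c h f G L V"
    and theta: "\<theta> = b * (real CARD('t) * h) * Lip (\<lambda>u. f u - c * u) * zeta a b c G L h"
  shows "0 \<le> \<theta>" and "norm ((\<Phi> X - X) - (\<Phi> Y - Y)) \<le> \<theta> * norm (X - Y)"
proof -
  let ?M = "M_op a b c h G L :: real^('t \<times> ('x \<times> 'x))^('t \<times> ('x \<times> 'x))"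
  define g where "g u = f u - c * u" for u
  obtain C where "C-lipschitz_on UNIV f" using f by blast
  then have "(C + \<bar>c\<bar> * 1)-lipschitz_on UNIV g"
    unfolding g_def by (intro lipschitz_intros)
  then have g: "(Lip g)-lipschitz_on UNIV g"
    using lipschitz_on_Lip by blast
  then have Lip0: "0 \<le> Lip g" by (rule lipschitz_on_nonneg)
  have zeta0: "0 \<le> zeta a b c G L h"
    by (rule implicit_step_bound(2)[OF nonneg G L comm, of 0 0 0]) simp
  show "0 \<le> \<theta>"
    unfolding theta g_def[symmetric] using Lip0 zeta0 nonneg by simp
  have inv: "invertible ?M"
    using invertible_M_op[OF nonneg G L comm] by blast
  define d where "d = entrywise g X - entrywise g Y"
  define y where "y = matrix_inv ?M *v (lift_op G *v d)"
  have "?M *v y = lift_op G *v d"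
    unfolding y_def using inv by (rule matrix_inv_cancel)
  then have y: "norm y \<le> real CARD('t) * zeta a b c G L h * norm d"
    by (rule M_op_bound[OF nonneg G L comm])
  have d: "norm d \<le> Lip g * norm (X - Y)"
  proof -
    have "norm d = L2_set (\<lambda>i. \<bar>g (X $ i) - g (Y $ i)\<bar>) UNIV"
      by (simp add: d_def entrywise_def norm_vec_def)
    also have "\<dots> \<le> L2_set (\<lambda>i. Lip g * \<bar>X $ i - Y $ i\<bar>) UNIV"
      using lipschitz_onD[OF g] by (intro L2_set_mono) (auto simp: dist_real_def)
    also have "\<dots> = Lip g * norm (X - Y)"
      by (simp add: L2_set_right_distrib[OF Lip0, symmetric] norm_vec_def)
    finally show ?thesis .
  qed
  have "(\<Phi> X - X) - (\<Phi> Y - Y) = (b * h) *\<^sub>R y"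
    unfolding Phi F_hat_eq[OF inv] y_def d_def g_def
    by (simp add: matrix_vector_mult_diff_distrib scaleR_diff_right)
  then have "norm ((\<Phi> X - X) - (\<Phi> Y - Y)) = b * h * norm y"
    using nonneg by simp
  also have "\<dots> \<le> b * h * (real CARD('t) * zeta a b c G L h * (Lip g * norm (X - Y)))"
    using nonneg zeta0
    by (intro mult_left_mono[OF order_trans[OF y mult_left_mono[OF d]]]) auto
  also have "\<dots> = \<theta> * norm (X - Y)"
    unfolding theta g_def[symmetric] by simp
  finally show "norm ((\<Phi> X - X) - (\<Phi> Y - Y)) \<le> \<theta> * norm (X - Y)" .
qed

section \<open>Differentiability and Jacobians\<close>

lemma entrywise_differentiable:
  assumes "\<And>x. g differentiable (at x)"
  shows "entrywise g differentiable (at U)"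
proof -
  from assms have "\<forall>x. \<exists>D. (g has_derivative D) (at x)"
    by (simp add: differentiable_def)
  then obtain D where D: "\<And>x. (g has_derivative D x) (at x)"
    by metis
  have "((\<lambda>x. g (x $ i)) has_derivative (\<lambda>v. D (U $ i) (v $ i))) (at U)" for i
    using has_derivative_compose[OF bounded_linear.has_derivative[OF bounded_linear_vec_nth
        has_derivative_ident] D] .
  then have "(entrywise g has_derivative (\<lambda>v. \<chi> i. D (U $ i) (v $ i))) (at U)"
    by (subst has_derivative_componentwise_within)
      (auto simp: Basis_vec_def entrywise_def inner_axis)
  then show ?thesis by (rule differentiableI)
qed

lemma F_hat_differentiable:
  fixes V :: "real^('t::{finite,linorder} \<times> ('x::finite \<times> 'x))"
  assumes "invertible (M_op a b c h G L :: real^('t \<times> ('x \<times> 'x))^('t \<times> ('x \<times> 'x)))"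
    and "f C1_differentiable_on UNIV"
  shows "F_hat a b c h f G L V differentiable (at U)"
proof -
  have "f differentiable (at x)" for x
    using assms(2) by (simp add: C1_differentiable_on_eq)
  then have "(\<lambda>u. f u - c * u) differentiable (at x)" for x
    by (intro derivative_intros)
  then obtain D where D: "(entrywise (\<lambda>u. f u - c * u) has_derivative D) (at U)"
    using entrywise_differentiable unfolding differentiable_def by blast
  let ?M = "matrix_inv (M_op a b c h G L) :: real^('t \<times> ('x \<times> 'x))^('t \<times> ('x \<times> 'x))"
  have "((\<lambda>x. ?M *v (lift_op G *v entrywise (\<lambda>u. f u - c * u) x)) has_derivative
      (\<lambda>v. ?M *v (lift_op G *v D v))) (at U)"
    by (intro bounded_linear.has_derivative[OF matrix_vector_mul_bounded_linear] D)
  then have "((\<lambda>U. U + (b * h) *\<^sub>R (?M *v (lift_op G *v entrywise (\<lambda>u. f u - c * u) U)) - ?M *v V)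
      has_derivative (\<lambda>v. v + (b * h) *\<^sub>R (?M *v (lift_op G *v D v)) - 0)) (at U)"
    by (intro has_derivative_diff has_derivative_add has_derivative_ident has_derivative_const
        has_derivative_scaleR_right)
  then have "(\<lambda>U. U + (b * h) *\<^sub>R (?M *v (lift_op G *v entrywise (\<lambda>u. f u - c * u) U)) - ?M *v V)
      differentiable (at U)"
    by (rule differentiableI)
  moreover have "F_hat a b c h f G L V =
      (\<lambda>U. U + (b * h) *\<^sub>R (?M *v (lift_op G *v entrywise (\<lambda>u. f u - c * u) U)) - ?M *v V)"
    using F_hat_eq[OF assms(1)] by (rule ext)
  ultimately show ?thesis by simp
qed

text \<open>Along the line \<open>U + t v\<close> the difference quotients of
  \<open>\<Phi> - id\<close> are bounded by \<open>\<theta> * norm v\<close>, and the bound survives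
  the limit \<open>A v - v\<close>.\<close>

lemma derivative_perturbation:
  fixes \<Phi> :: "real^'n \<Rightarrow> real^'n"
  assumes D: "(\<Phi> has_derivative (\<lambda>v. A *v v)) (at U)"
    and pert: "\<And>X Y. norm ((\<Phi> X - X) - (\<Phi> Y - Y)) \<le> \<theta> * norm (X - Y)"
  shows "norm (A *v v - v) \<le> \<theta> * norm v"
proof -
  define k where "k t = \<Phi> (U + t *\<^sub>R v) - (U + t *\<^sub>R v)" for t
  have line: "((\<lambda>t. U + t *\<^sub>R v) has_derivative (\<lambda>t. t *\<^sub>R v)) (at 0)"
    by (auto intro!: derivative_eq_intros)
  have "((\<lambda>t. \<Phi> (U + t *\<^sub>R v)) has_derivative (\<lambda>t. A *v (t *\<^sub>R v))) (at 0)"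
    by (rule has_derivative_compose[OF line]) (simp add: D)
  then have "(k has_derivative (\<lambda>t. A *v (t *\<^sub>R v) - t *\<^sub>R v)) (at 0)"
    unfolding k_def using line by (rule has_derivative_diff)
  then have "(k has_vector_derivative (A *v v - v)) (at 0)"
    by (simp add: has_vector_derivative_def matrix_vector_mult_scaleR scaleR_diff_right)
  then have deriv: "\<forall>e>0. \<exists>d>0. \<forall>t. t \<noteq> 0 \<and> \<bar>t\<bar> < d \<longrightarrow>
      norm (k t - k 0 - t *\<^sub>R (A *v v - v)) / \<bar>t\<bar> < e"
    by (simp add: has_vector_derivative_def has_derivative_within')
  have quot: "norm ((1 / t) *\<^sub>R (k t - k 0) - (A *v v - v)) =
      norm (k t - k 0 - t *\<^sub>R (A *v v - v)) / \<bar>t\<bar>" if "t \<noteq> 0" for t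
  proof -
    have "(1 / t) *\<^sub>R (k t - k 0) - (A *v v - v) = (1 / t) *\<^sub>R (k t - k 0 - t *\<^sub>R (A *v v - v))"
      using that by (simp add: scaleR_diff_right)
    then show ?thesis by simp
  qed
  have "((\<lambda>t. (1 / t) *\<^sub>R (k t - k 0)) \<longlongrightarrow> A *v v - v) (at 0)"
    unfolding LIM_eq using deriv by (simp add: quot)
  moreover have "norm ((1 / t) *\<^sub>R (k t - k 0)) \<le> \<theta> * norm v" if "t \<noteq> 0" for t
  proof -
    have "norm (k t - k 0) \<le> \<theta> * norm ((U + t *\<^sub>R v) - (U + 0 *\<^sub>R v))"
      unfolding k_def by (rule pert)
    then show ?thesis using that by (simp add: divide_simps mult_ac)
  qed
  ultimately show ?thesis
    by (intro Lim_norm_ubound[of "at (0::real)"]) (auto simp: eventually_at_filter)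
qed

section \<open>Singular values of near-identity matrices\<close>

lemma near_identity_invertible:
  fixes A :: "real^'n^'n"
  assumes A: "\<And>v. norm (A *v v - v) \<le> \<theta> * norm v" and \<theta>: "\<theta> < 1"
  shows "invertible A"
proof -
  have "v = 0" if "A *v v = 0" for v
  proof -
    have "(1 - \<theta>) * norm v \<le> 0" using A[of v] that by (simp add: algebra_simps)
    then show ?thesis using \<theta> by (simp add: mult_le_0_iff)
  qed
  then have "inj ((*v) A)"
    by (metis (no_types) eq_iff_diff_eq_0 injI matrix_vector_mult_diff_distrib)
  then show ?thesis
    by (simp add: invertible_left_inverse matrix_left_invertible_injective)
qed

lemma self_adjoint_gram: "self_adjoint (transpose A ** A)"
  by (simp add: self_adjoint_def matrix_transpose_mul)

lemma inner_gram:
  fixes A :: "real^'n^'n"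
  shows "v \<bullet> ((transpose A ** A) *v v) = (norm (A *v v))\<^sup>2"
  by (metis inner_commute inner_transpose_matrix matrix_vector_mul_assoc power2_norm_eq_inner)

text \<open>Makes \<open>Min\<close> and \<open>Max\<close> in \<open>sigma_min\<close> and
  \<open>sigma_max\<close> meaningful. The square of a singular value is one of the eigenvalues
  found in an orthonormal eigenbasis of the Gram matrix.\<close>

lemma singular_values_finite_nonempty:
  fixes A :: "real^'n^'n"
  shows "finite (singular_values A)" and "singular_values A \<noteq> {}"
proof -
  let ?P = "transpose A ** A"
  obtain v \<alpha> \<beta> where "common_eigenbasis ?P ?P v \<alpha> \<beta>"
    using commuting_common_eigenbasis[OF self_adjoint_gram self_adjoint_gram refl] .
  then have orth: "\<forall>k l. v k \<bullet> v l = (if k = l then 1 else 0)" and Pv: "?P *v v k = \<alpha> k *\<^sub>R v k" for k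
    by (auto simp: common_eigenbasis_def)
  have "singular_values A \<subseteq> range (\<lambda>k. sqrt (\<alpha> k))"
  proof
    fix s assume "s \<in> singular_values A"
    then obtain w where s: "0 \<le> s" and w: "w \<noteq> 0" "?P *v w = s\<^sup>2 *\<^sub>R w"
      by (auto simp: singular_values_def)
    have "\<exists>k. w \<bullet> v k \<noteq> 0"
    proof (rule ccontr)
      assume "\<not> (\<exists>k. w \<bullet> v k \<noteq> 0)"
      then have "w \<bullet> w = 0" by (subst orthonormal_family_inner[OF orth]) simp
      then show False using w by simp
    qed
    \<comment> \<open>Pairing the eigenvector equation of \<open>w\<close> with a basis vector not
      orthogonal to \<open>w\<close> identifies the two eigenvalues.\<close>
    then obtain k where k: "w \<bullet> v k \<noteq> 0" by blast
    have "(?P *v w) \<bullet> v k = \<alpha> k * (w \<bullet> v k)"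
      unfolding self_adjoint_inner[OF self_adjoint_gram] Pv by simp
    then have "s\<^sup>2 = \<alpha> k" using k w by simp
    then have "s = sqrt (\<alpha> k)" using s by (metis real_sqrt_unique)
    then show "s \<in> range (\<lambda>k. sqrt (\<alpha> k))" by blast
  qed
  then show "finite (singular_values A)" by (rule finite_subset) simp
  fix k :: 'n
  have nv: "v k \<bullet> v k = 1" using orth by simp
  have "\<alpha> k = (norm (A *v v k))\<^sup>2"
    using inner_gram[of "v k" A] nv unfolding Pv by simp
  moreover have "v k \<noteq> 0" using nv by auto
  ultimately have "norm (A *v v k) \<in> singular_values A"
    unfolding singular_values_def using Pv by auto
  then show "singular_values A \<noteq> {}" by blast
qed

text \<open>For a singular vector \<open>v\<close>, \<open>norm (A v) = s * norm v\<close>, and the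
  reverse triangle inequality keeps this within \<open>\<theta> * norm v\<close> of
  \<open>norm v\<close>.\<close>

lemma singular_values_near_identity:
  fixes A :: "real^'n^'n"
  assumes A: "\<And>v. norm (A *v v - v) \<le> \<theta> * norm v" and s: "s \<in> singular_values A"
  shows "1 - \<theta> \<le> s" and "s \<le> 1 + \<theta>"
proof -
  obtain v where v: "0 \<le> s" "v \<noteq> 0" "(transpose A ** A) *v v = s\<^sup>2 *\<^sub>R v"
    using s by (auto simp: singular_values_def)
  have "(norm (A *v v))\<^sup>2 = (s * norm v)\<^sup>2"
    using inner_gram[of v A] v by (simp add: power_mult_distrib power2_norm_eq_inner)
  then have n: "norm (A *v v) = s * norm v"
    using v by (simp add: power2_eq_iff_nonneg)
  have "norm v - norm (A *v v) \<le> \<theta> * norm v" "norm (A *v v) - norm v \<le> \<theta> * norm v"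
    using A[of v] norm_triangle_ineq2[of v "A *v v"] norm_triangle_ineq2[of "A *v v" v]
    by (simp_all add: norm_minus_commute)
  then have "(1 - \<theta>) * norm v \<le> s * norm v" "s * norm v \<le> (1 + \<theta>) * norm v"
    unfolding n by (simp_all add: algebra_simps)
  then show "1 - \<theta> \<le> s" "s \<le> 1 + \<theta>"
    using v by simp_all
qed

text \<open>The flow involves \<open>A A^T\<close>, whereas singular values are defined through
  \<open>A^T A\<close>. The transpose carries eigenvectors of the former to eigenvectors of the
  latter, nonzero by invertibility.\<close>

lemma sqrt_eigenvalue_singular_value:
  fixes A :: "real^'n^'n"
  assumes A: "invertible A" and v: "v \<noteq> 0" "(A ** transpose A) *v v = p *\<^sub>R v"
  shows "0 \<le> p" and "sqrt p \<in> singular_values A"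
proof -
  have "v \<bullet> ((A ** transpose A) *v v) = (norm (transpose A *v v))\<^sup>2"
    using inner_gram[of v "transpose A"] by simp
  then have "p * (v \<bullet> v) = (norm (transpose A *v v))\<^sup>2"
    using v by simp
  then show p: "0 \<le> p"
    using v by (metis inner_gt_zero_iff zero_le_mult_iff zero_le_power2 not_le)
  have "transpose A *v v \<noteq> 0"
  proof
    assume 0: "transpose A *v v = 0"
    have "inj ((*v) (transpose A))"
      using A by (simp add: inj_matrix_vector_mult transpose_invertible)
    from injD[OF this, of v 0] have "v = 0"
      by (simp only: 0 matrix_vector_mult_0_right)
    then show False using v by simp
  qed
  moreover have "(transpose A ** A) *v (transpose A *v v) = p *\<^sub>R (transpose A *v v)"
    using arg_cong[OF v(2), of "(*v) (transpose A)"]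
    by (simp add: matrix_vector_mul_assoc[symmetric] matrix_vector_mult_scaleR
        del: matrix_vector_mul_assoc)
  ultimately show "sqrt p \<in> singular_values A"
    unfolding singular_values_def using p by auto
qed

section \<open>Decay of the Lyapunov function\<close>

text \<open>Multiply by \<open>4 * P\<close> and complete the square in \<open>x\<close>.\<close>

lemma quadratic_form_nonneg:
  fixes x q :: real
  assumes "0 < P" and "d\<^sup>2 \<le> 4 * P * Q"
  shows "0 \<le> P * x\<^sup>2 + Q * q\<^sup>2 - d * x * q"
proof -
  have "0 \<le> (2 * P * x - d * q)\<^sup>2 + (4 * P * Q - d\<^sup>2) * q\<^sup>2"
    using assms(2) by simp
  also have "\<dots> = 4 * P * (P * x\<^sup>2 + Q * q\<^sup>2 - d * x * q)"
    by (simp add: power2_eq_square algebra_simps)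
  finally show ?thesis using assms(1) by (simp add: zero_le_mult_iff)
qed

lemma square_convex_combination:
  fixes x y l :: real
  assumes "0 \<le> l" "l \<le> 1"
  shows "((1 - l) * x + l * y)\<^sup>2 \<le> (1 - l) * x\<^sup>2 + l * y\<^sup>2"
proof -
  have "(1 - l) * x\<^sup>2 + l * y\<^sup>2 - ((1 - l) * x + l * y)\<^sup>2 = l * (1 - l) * (x - y)\<^sup>2"
    by (simp add: power2_eq_square algebra_simps)
  moreover have "0 \<le> l * (1 - l) * (x - y)\<^sup>2" using assms by simp
  ultimately show ?thesis by linarith
qed

text \<open>The discriminant condition at the smallest eigenvalue, with
  \<open>u = 1 / \<kappa>\<close>. Crude constants suffice on each half of the range: the left side
  is at most 1/4 and then 1/16, while the right side, decreasing in \<open>u\<close>, exceeds 3/4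
  and then 1/5.\<close>

lemma discriminant_endpoint:
  fixes u :: real
  assumes "0 < u" "u \<le> 1"
  shows "(1 / 2 - u + u\<^sup>2 / 4)\<^sup>2 \<le> 2 * (27 / 32 - u / 2) * (1 - 21 / 32 * u)"
proof -
  have u2: "u\<^sup>2 \<le> u" "0 \<le> u\<^sup>2" using assms by (auto simp: power2_eq_square mult_left_le)
  show ?thesis
  proof (cases "u \<le> 1 / 2")
    case True
    have "0 \<le> 1 / 2 - u + u\<^sup>2 / 4" "1 / 2 - u + u\<^sup>2 / 4 \<le> 1 / 2"
      using True u2 assms by linarith+
    then have "(1 / 2 - u + u\<^sup>2 / 4)\<^sup>2 \<le> (1 / 2)\<^sup>2" by (intro power_mono)
    moreover have "2 * (27 / 32 - 1 / 4) * (1 - 21 / 64) \<le> 2 * (27 / 32 - u / 2) * (1 - 21 / 32 * u)"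
      using True by (intro mult_mono) auto
    ultimately show ?thesis by (simp add: power2_eq_square)
  next
    case False
    have "0 \<le> (u - 1)\<^sup>2" by simp
    \<comment> \<open>The tangent line of the square at \<open>u = 1\<close> gives the linear lower
      bound needed for the absolute value.\<close>
    then have "u\<^sup>2 \<ge> 2 * u - 1" by (simp add: power2_eq_square algebra_simps)
    then have "\<bar>1 / 2 - u + u\<^sup>2 / 4\<bar> \<le> 1 / 4"
      using False assms u2 by linarith
    then have "(1 / 2 - u + u\<^sup>2 / 4)\<^sup>2 \<le> (1 / 4)\<^sup>2" by (rule abs_le_square_iff[THEN iffD1, OF order_trans]) simp
    moreover have "2 * (27 / 32 - 1 / 2) * (1 - 21 / 32) \<le> 2 * (27 / 32 - u / 2) * (1 - 21 / 32 * u)"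
      using assms by (intro mult_mono) auto
    ultimately show ?thesis by (simp add: power2_eq_square)
  qed
qed

text \<open>Both sides are compared at \<open>y = 1\<close> and \<open>y = \<kappa>\<^sup>2\<close> only; the left-hand side is convex and the
  right-hand side affine in \<open>y\<close>.\<close>

lemma discriminant_scaled:
  fixes \<kappa> y :: real
  assumes \<kappa>: "1 \<le> \<kappa>" and y: "1 \<le> y" "y \<le> \<kappa>\<^sup>2"
  shows "(1 / 2 - (\<kappa> - 1 / 4) / \<kappa>\<^sup>2 * y)\<^sup>2
    \<le> 2 * ((\<kappa> - 1 / 2) / \<kappa>\<^sup>2 * y - 5 / (32 * \<kappa>)) * (\<kappa> - 21 / 32)"
proof -
  define L where "L y = 1 / 2 - (\<kappa> - 1 / 4) / \<kappa>\<^sup>2 * y" for y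
  define R where "R y = 2 * ((\<kappa> - 1 / 2) / \<kappa>\<^sup>2 * y - 5 / (32 * \<kappa>)) * (\<kappa> - 21 / 32)" for y
  have k0: "\<kappa> > 0" using \<kappa> by simp
  have one: "(L 1)\<^sup>2 \<le> R 1"
  proof -
    have "L 1 = 1 / 2 - 1 / \<kappa> + (1 / \<kappa>)\<^sup>2 / 4"
      unfolding L_def using k0 by (simp add: field_simps power2_eq_square)
    moreover have "R 1 = 2 * (27 / 32 - 1 / \<kappa> / 2) * (1 - 21 / 32 * (1 / \<kappa>))"
      unfolding R_def using k0 by (simp add: field_simps power2_eq_square)
    ultimately show ?thesis using discriminant_endpoint[of "1 / \<kappa>"] \<kappa> by simp
  qed
  have top: "(L (\<kappa>\<^sup>2))\<^sup>2 \<le> R (\<kappa>\<^sup>2)"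
  proof -
    have "(L (\<kappa>\<^sup>2))\<^sup>2 = (\<kappa> - 3 / 4)\<^sup>2"
      unfolding L_def using k0 by (simp add: power2_commute[of \<kappa>])
    also have "\<dots> \<le> (\<kappa> - 21 / 32)\<^sup>2"
      using \<kappa> by (intro power_mono) auto
    also have "\<dots> \<le> 2 * (\<kappa> - 21 / 32) * (\<kappa> - 21 / 32)"
      using \<kappa> by (simp add: power2_eq_square mult_right_mono)
    \<comment> \<open>Uses \<open>21 / 32 = 1 / 2 + 5 / 32\<close> and
      \<open>5 / (32 * \<kappa>) \<le> 5 / 32\<close>.\<close>
    also have "\<dots> \<le> 2 * (\<kappa> - 1 / 2 - 5 / (32 * \<kappa>)) * (\<kappa> - 21 / 32)"
      using \<kappa> by (intro mult_right_mono) (auto simp: field_simps)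
    also have "\<dots> = R (\<kappa>\<^sup>2)"
      unfolding R_def using k0 by simp
    finally show ?thesis .
  qed
  have "(L y)\<^sup>2 \<le> R y"
  \<comment> \<open>For \<open>\<kappa> = 1\<close> the two endpoints coincide and the interpolation
    parameter \<open>l\<close> would have denominator zero.\<close>
  proof (cases "\<kappa> = 1")
    case True
    then have "y = 1" using y by simp
    then show ?thesis using one by simp
  next
    case False
    then have k1: "\<kappa>\<^sup>2 > 1" using \<kappa> by simp
    define l where "l = (y - 1) / (\<kappa>\<^sup>2 - 1)"
    have l: "0 \<le> l" "l \<le> 1" unfolding l_def using y k1 by simp_all
    have yl: "y = (1 - l) * 1 + l * \<kappa>\<^sup>2"
    proof -
      have "l * (\<kappa>\<^sup>2 - 1) = y - 1" unfolding l_def using k1 by simp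
      then show ?thesis by (simp add: algebra_simps)
    qed
    have "L ((1 - l) * 1 + l * \<kappa>\<^sup>2) = (1 - l) * L 1 + l * L (\<kappa>\<^sup>2)"
      unfolding L_def by algebra
    then have "L y = (1 - l) * L 1 + l * L (\<kappa>\<^sup>2)"
      by (simp only: yl[symmetric])
    then have "(L y)\<^sup>2 \<le> (1 - l) * (L 1)\<^sup>2 + l * (L (\<kappa>\<^sup>2))\<^sup>2"
      using square_convex_combination[OF l] by simp
    also have "\<dots> \<le> (1 - l) * R 1 + l * R (\<kappa>\<^sup>2)"
      using l one top by (intro add_mono mult_left_mono) auto
    also have "\<dots> = R ((1 - l) * 1 + l * \<kappa>\<^sup>2)"
      unfolding R_def by algebra
    also have "\<dots> = R y"
      by (simp only: yl[symmetric])
    finally show ?thesis .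
  qed
  then show ?thesis by (simp add: L_def R_def)
qed

text \<open>The dissipation of a single eigenmode of \<open>J J^T\<close> with eigenvalue
  \<open>p\<close>, reduced by the rate \<open>r\<close>. Scaling by \<open>p = s^2 * y\<close>
  leaves only \<open>\<kappa>\<close> and \<open>y\<close> between 1 and the square of
  \<open>\<kappa>\<close>. The second bound on \<open>r\<close> serves the coefficient of
  \<open>x\<close>, the first that of \<open>q\<close>.\<close>

lemma pdhg_scalar_decay:
  fixes s S p r x q :: real
  defines "\<kappa> \<equiv> S / s"
  defines "\<epsilon> \<equiv> \<kappa> - 1 / 2" and "\<gamma> \<equiv> 1 / \<kappa> - 1 / (2 * \<kappa>\<^sup>2)" and "\<mu> \<equiv> s\<^sup>2 / 2"
  assumes s: "0 < s" "s \<le> S" and p: "s\<^sup>2 \<le> p" "p \<le> S\<^sup>2"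
    and r: "r \<le> 5 / 32" "r \<le> 5 / 32 * (s ^ 3 / S)"
  shows "0 \<le> (\<gamma> * p - r) * x\<^sup>2 + \<mu> * (\<epsilon> - r) * q\<^sup>2 - (\<mu> - (1 - \<gamma> * \<epsilon>) * p) * x * q"
proof -
  have \<kappa>: "1 \<le> \<kappa>" unfolding \<kappa>_def using s by simp
  have S: "S = \<kappa> * s" unfolding \<kappa>_def using s by simp
  define y where "y = p / s\<^sup>2"
  have py: "p = s\<^sup>2 * y" unfolding y_def using s by simp
  have y: "1 \<le> y" "y \<le> \<kappa>\<^sup>2"
    using p s unfolding y_def S by (simp_all add: field_simps)
  define X where "X = (\<kappa> - 1 / 2) / \<kappa>\<^sup>2 * y - 5 / (32 * \<kappa>)"
  have \<gamma>: "\<gamma> = (\<kappa> - 1 / 2) / \<kappa>\<^sup>2"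
    unfolding \<gamma>_def using \<kappa> by (simp add: field_simps power2_eq_square)
  have \<delta>: "1 - \<gamma> * \<epsilon> = (\<kappa> - 1 / 4) / \<kappa>\<^sup>2"
    unfolding \<gamma> \<epsilon>_def using \<kappa> by (simp add: field_simps power2_eq_square)
  have Xpos: "0 < X"
  proof -
    have "0 < (27 / 32 * \<kappa> - 1 / 2) / \<kappa>\<^sup>2" using \<kappa> by simp
    also have "\<dots> = (\<kappa> - 1 / 2) / \<kappa>\<^sup>2 * 1 - 5 / (32 * \<kappa>)"
      using \<kappa> by (simp add: field_simps power2_eq_square)
    also have "\<dots> \<le> X"
      unfolding X_def using \<kappa> y by (intro diff_right_mono mult_left_mono) auto
    finally show ?thesis .
  qed
  have "r \<le> s\<^sup>2 * (5 / (32 * \<kappa>))"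
    using r(2) s \<kappa> unfolding S by (simp add: field_simps power2_eq_square power3_eq_cube)
  then have P: "s\<^sup>2 * X \<le> \<gamma> * p - r"
    unfolding X_def \<gamma> py by (simp add: algebra_simps)
  have Ppos: "0 < \<gamma> * p - r"
    using P Xpos s by (meson less_le_trans mult_pos_pos zero_less_power)
  have e: "\<kappa> - 21 / 32 \<le> \<epsilon> - r" unfolding \<epsilon>_def using r(1) by simp
  have "\<mu> - (1 - \<gamma> * \<epsilon>) * p = s\<^sup>2 * (1 / 2 - (\<kappa> - 1 / 4) / \<kappa>\<^sup>2 * y)"
    unfolding \<delta> \<mu>_def py by (simp add: right_diff_distrib)
  then have "(\<mu> - (1 - \<gamma> * \<epsilon>) * p)\<^sup>2 = (s\<^sup>2)\<^sup>2 * (1 / 2 - (\<kappa> - 1 / 4) / \<kappa>\<^sup>2 * y)\<^sup>2"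
    by (simp only: power_mult_distrib)
  also have "\<dots> \<le> (s\<^sup>2)\<^sup>2 * (2 * X * (\<kappa> - 21 / 32))"
    using discriminant_scaled[OF \<kappa> y] unfolding X_def by (intro mult_left_mono) auto
  also have "\<dots> = 4 * (s\<^sup>2 * X) * (\<mu> * (\<kappa> - 21 / 32))"
    unfolding \<mu>_def by (simp add: power2_eq_square)
  also have "\<dots> \<le> 4 * (\<gamma> * p - r) * (\<mu> * (\<epsilon> - r))"
    using P e Ppos Xpos s \<kappa> unfolding \<mu>_def by (intro mult_mono) auto
  finally have "(\<mu> - (1 - \<gamma> * \<epsilon>) * p)\<^sup>2 \<le> 4 * (\<gamma> * p - r) * (\<mu> * (\<epsilon> - r))" .
  with Ppos show ?thesis by (rule quadratic_form_nonneg)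
qed

text \<open>In an orthonormal eigenbasis of \<open>P\<close> all five terms are diagonal, so the
  form is a sum of binary forms in the coordinates of \<open>x\<close> and \<open>q\<close>.\<close>

lemma self_adjoint_form_nonneg:
  fixes P :: "real^'n^'n"
  assumes P: "self_adjoint P"
    and ev: "\<And>v p \<xi> \<eta>. \<lbrakk>v \<noteq> 0; P *v v = p *\<^sub>R v\<rbrakk> \<Longrightarrow>
      0 \<le> (g * p - r) * \<xi>\<^sup>2 + m * \<eta>\<^sup>2 - (\<mu> - d * p) * \<xi> * \<eta>"
  shows "0 \<le> g * (x \<bullet> (P *v x)) - r * (x \<bullet> x) + m * (q \<bullet> q) - \<mu> * (x \<bullet> q) + d * (x \<bullet> (P *v q))"
proof -
  obtain v \<alpha> \<beta> where "common_eigenbasis P P v \<alpha> \<beta>"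
    using commuting_common_eigenbasis[OF P P refl] .
  then have orth: "\<forall>k l. v k \<bullet> v l = (if k = l then 1 else 0)" and Pv: "P *v v k = \<alpha> k *\<^sub>R v k" for k
    by (auto simp: common_eigenbasis_def)
  have v0: "v k \<noteq> 0" for k
    using orth by (metis inner_zero_left zero_neq_one)
  have Pk: "(P *v z) \<bullet> v k = \<alpha> k * (z \<bullet> v k)" for z k
    unfolding self_adjoint_inner[OF P] Pv by simp
  note inner = orthonormal_family_inner[OF orth]
  have "g * (x \<bullet> (P *v x)) - r * (x \<bullet> x) + m * (q \<bullet> q) - \<mu> * (x \<bullet> q) + d * (x \<bullet> (P *v q)) =
    (\<Sum>k\<in>UNIV. (g * \<alpha> k - r) * (x \<bullet> v k)\<^sup>2 + m * (q \<bullet> v k)\<^sup>2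
      - (\<mu> - d * \<alpha> k) * (x \<bullet> v k) * (q \<bullet> v k))"
    unfolding inner[of x "P *v x"] inner[of x x] inner[of q q] inner[of x q] inner[of x "P *v q"] Pk
    by (simp add: sum_distrib_left sum_subtractf[symmetric] sum.distrib[symmetric]
        power2_eq_square algebra_simps)
  also have "0 \<le> \<dots>"
    by (intro sum_nonneg ev[OF v0 Pv])
  finally show ?thesis .
qed

section \<open>Integration along the flow\<close>

text \<open>Gronwall's argument: \<open>exp (k * t) * E t\<close> has nonpositive
  derivative.\<close>

lemma exponential_decay:
  fixes E E' :: "real \<Rightarrow> real"
  assumes D: "\<And>t. 0 \<le> t \<Longrightarrow> (E has_real_derivative E' t) (at t within {0..})"
    and le: "\<And>t. 0 \<le> t \<Longrightarrow> E' t \<le> - k * E t" and t: "0 \<le> t"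
  shows "E t \<le> exp (- k * t) * E 0"
proof -
  define F where "F t = exp (k * t) * E t" for t
  have F: "(F has_real_derivative exp (k * t) * (k * E t + E' t)) (at t within {0..})" if "0 \<le> t" for t
    unfolding F_def by (rule derivative_eq_intros D[OF that] refl | simp add: algebra_simps)+
  have "F t \<le> F 0"
  proof (rule DERIV_nonpos_imp_decreasing_open[OF t])
    fix u assume u: "0 < u" "u < t"
    then have "at u within {0..} = at u"
      by (intro at_within_interior) (simp add: interior_Ici[of "-1"])
    then have "(F has_real_derivative exp (k * u) * (k * E u + E' u)) (at u)"
      using F[of u] u by simp
    moreover have "exp (k * u) * (k * E u + E' u) \<le> 0"
      using le[of u] u by (intro mult_nonneg_nonpos) auto
    ultimately show "\<exists>y. (F has_real_derivative y) (at u) \<and> y \<le> 0" by blast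
  next
    have "continuous_on {0..} F"
      unfolding continuous_on_eq_continuous_within using F DERIV_continuous by fastforce
    then show "continuous_on {0..t} F"
      by (rule continuous_on_subset) auto
  qed
  then show ?thesis
    by (simp add: F_def exp_minus field_simps)
qed

lemma pdhg_flow_decay:
  fixes \<Phi> :: "real^'n \<Rightarrow> real^'n"
  assumes diff: "\<And>U. \<Phi> differentiable (at U)"
    and pert: "\<And>X Y. norm ((\<Phi> X - X) - (\<Phi> Y - Y)) \<le> \<theta> * norm (X - Y)"
    and \<theta>: "0 \<le> \<theta>" "\<theta> < 1"
    and sigma_lo: "\<sigma>lo = (INF U. sigma_min (jacobian \<Phi> (at U)))"
    and sigma_hi: "\<sigma>hi = (SUP U. sigma_max (jacobian \<Phi> (at U)))"
    and kappa: "\<kappa> = \<sigma>hi / \<sigma>lo"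
    and epsilon: "\<epsilon> = \<kappa> - 1 / 2"
    and gamma: "\<gamma> = 1 / \<kappa> - 1 / (2 * \<kappa>\<^sup>2)"
    and sol: "pdhg_solution \<epsilon> \<gamma> \<Phi> U Q" and t: "0 \<le> t"
  shows "norm (\<Phi> (U t)) \<le> exp (- (5 / 32) * ((1 - \<theta>) ^ 3 / (1 + \<theta>)) * t) *
    sqrt ((norm (\<Phi> (U 0)))\<^sup>2 + (1 + \<theta>) * (norm (Q 0))\<^sup>2)"
proof -
  define J where "J X = jacobian \<Phi> (at X)" for X
  have DJ: "(\<Phi> has_derivative (\<lambda>v. J X *v v)) (at X)" for X
    using diff[of X] jacobian_works unfolding J_def by blast
  have J: "norm (J X *v v - v) \<le> \<theta> * norm v" for X v
    by (rule derivative_perturbation[OF DJ pert])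
  note sv = singular_values_finite_nonempty[of "J _"]
  note bounds = singular_values_near_identity[OF J]
  have smin: "sigma_min (J X) \<in> singular_values (J X)" and smax: "sigma_max (J X) \<in> singular_values (J X)" for X
    unfolding sigma_min_def sigma_max_def using sv by (auto intro: Min_in Max_in)
  \<comment> \<open>The infimum and supremum over all \<open>U\<close> are comparable with single
    values only once the ranges are known to be bounded.\<close>
  have bdd: "bdd_below (range (\<lambda>X. sigma_min (J X)))" "bdd_above (range (\<lambda>X. sigma_max (J X)))"
    using bounds[OF smin] bounds[OF smax] by (auto intro!: bdd_belowI bdd_aboveI)
  have lo_le: "\<sigma>lo \<le> sigma_min (J X)" and hi_ge: "sigma_max (J X) \<le> \<sigma>hi" for X
    unfolding sigma_lo sigma_hi J_def[symmetric] using bdd by (auto intro: cINF_lower cSUP_upper)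
  have lo: "1 - \<theta> \<le> \<sigma>lo" and hi: "\<sigma>hi \<le> 1 + \<theta>"
    unfolding sigma_lo sigma_hi J_def[symmetric]
    using bounds[OF smin] bounds[OF smax] by (auto intro: cINF_greatest cSUP_least)
  have "sigma_min (J 0) \<le> sigma_max (J 0)"
    unfolding sigma_max_def using smin sv by (auto intro: Max_ge)
  then have lohi: "0 < \<sigma>lo" "\<sigma>lo \<le> \<sigma>hi"
    using lo_le[of 0] hi_ge[of 0] lo \<theta> by auto
  \<comment> \<open>\<open>\<rho>\<close> bounds \<open>\<sigma>lo ^ 3 / \<sigma>hi\<close> from
    below, since \<open>1 - \<theta> \<le> \<sigma>lo\<close> and
    \<open>\<sigma>hi \<le> 1 + \<theta>\<close>; thus \<open>r\<close> satisfies both rate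
    conditions of the scalar estimate.\<close>
  define \<rho> where "\<rho> = (1 - \<theta>) ^ 3 / (1 + \<theta>)"
  define r where "r = 5 / 32 * \<rho>"
  define \<mu> where "\<mu> = \<sigma>lo\<^sup>2 / 2"
  have "\<rho> \<le> 1 / 1"
    unfolding \<rho>_def using \<theta> by (intro frac_le power_le_one) auto
  then have r1: "r \<le> 5 / 32" unfolding r_def by simp
  have "\<rho> \<le> \<sigma>lo ^ 3 / \<sigma>hi"
    unfolding \<rho>_def using \<theta> lo hi lohi by (intro frac_le power_mono) auto
  then have r2: "r \<le> 5 / 32 * (\<sigma>lo ^ 3 / \<sigma>hi)" unfolding r_def by simp
  have form: "0 \<le> \<gamma> * (x \<bullet> (P *v x)) - r * (x \<bullet> x) + (\<mu> * (\<epsilon> - r)) * (q \<bullet> q)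
      - \<mu> * (x \<bullet> q) + (1 - \<gamma> * \<epsilon>) * (x \<bullet> (P *v q))"
    if P: "P = J X ** transpose (J X)" for x q X P
  proof (rule self_adjoint_form_nonneg)
    show "self_adjoint P"
      unfolding P using self_adjoint_gram[of "transpose (J X)"] by simp
    fix v p and \<xi> \<eta> :: real assume v: "v \<noteq> 0" "P *v v = p *\<^sub>R v"
    have "invertible (J X)" by (rule near_identity_invertible[OF J \<theta>(2)])
    from sqrt_eigenvalue_singular_value[OF this v[unfolded P]]
    have p0: "0 \<le> p" and sp: "sqrt p \<in> singular_values (J X)" by auto
    have "sigma_min (J X) \<le> sqrt p" "sqrt p \<le> sigma_max (J X)"
      unfolding sigma_min_def sigma_max_def using sp sv by (auto intro: Min_le Max_ge)
    then have "\<sigma>lo \<le> sqrt p" "sqrt p \<le> \<sigma>hi"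
      using lo_le[of X] hi_ge[of X] by auto
    then have p: "\<sigma>lo\<^sup>2 \<le> p" "p \<le> \<sigma>hi\<^sup>2"
      using power_mono[of \<sigma>lo "sqrt p" 2] power_mono[of "sqrt p" \<sigma>hi 2] lohi p0 by auto
    show "0 \<le> (\<gamma> * p - r) * \<xi>\<^sup>2 + \<mu> * (\<epsilon> - r) * \<eta>\<^sup>2 - (\<mu> - (1 - \<gamma> * \<epsilon>) * p) * \<xi> * \<eta>"
      using pdhg_scalar_decay[OF lohi p r1 r2] unfolding \<mu>_def epsilon gamma kappa .
  qed
  define x where "x t = \<Phi> (U t)" for t
  define E where "E t = x t \<bullet> x t + \<mu> * (Q t \<bullet> Q t)" for t
  define w where "w t = (1 - \<gamma> * \<epsilon>) *\<^sub>R Q t + \<gamma> *\<^sub>R x t" for t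
  define P where "P t = J (U t) ** transpose (J (U t))" for t
  have DQ: "(Q has_vector_derivative (- \<epsilon> *\<^sub>R Q t + x t)) (at t within {0..})"
    and DU: "(U has_vector_derivative - (transpose (J (U t)) *v w t)) (at t within {0..})" if "0 \<le> t" for t
    using sol that unfolding pdhg_solution_def x_def w_def J_def by auto
  have Dx: "(x has_vector_derivative - (P t *v w t)) (at t within {0..})" if "0 \<le> t" for t
  proof -
    have "(\<Phi> \<circ> U has_vector_derivative J (U t) *v (- (transpose (J (U t)) *v w t))) (at t within {0..})"
      by (rule vector_derivative_diff_chain_within[OF DU[OF that] has_derivative_at_withinI[OF DJ]])
    moreover have "J (U t) *v (- (transpose (J (U t)) *v w t)) = - (P t *v w t)"
      unfolding P_def linear_neg[OF matrix_vector_mul_linear] by (simp only: matrix_vector_mul_assoc)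
    ultimately show ?thesis by (simp only: x_def[abs_def] o_def)
  qed
  define E' where "E' t = 2 * (x t \<bullet> - (P t *v w t)) + \<mu> * (2 * (Q t \<bullet> (- \<epsilon> *\<^sub>R Q t + x t)))" for t
  have DE: "(E has_real_derivative E' t) (at t within {0..})" if "0 \<le> t" for t
  proof -
    have sq: "((\<lambda>t. y t \<bullet> y t) has_real_derivative 2 * (y t \<bullet> y')) (at t within {0..})"
      if "(y has_vector_derivative y') (at t within {0..})" for y :: "real \<Rightarrow> real^'n" and y'
      using has_derivative_inner[OF that[unfolded has_vector_derivative_def] that[unfolded has_vector_derivative_def]]
      unfolding has_field_derivative_def
      by (rule has_derivative_eq_rhs) (auto simp: inner_commute)
    show ?thesis
      unfolding E_def E'_def
      by (intro DERIV_add DERIV_cmult sq Dx[OF that] DQ[OF that])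
  qed
  \<comment> \<open>\<open>E' t + 2 * r * E t\<close> is exactly \<open>- 2\<close> times the
    nonnegative form; the square root taken at the end halves the rate \<open>2 * r\<close>.\<close>
  have "E' t \<le> - (2 * r) * E t" for t
    using form[OF P_def[of t], of "x t" "Q t"]
    unfolding E'_def E_def w_def
    by (simp add: algebra_simps inner_commute)
  from exponential_decay[OF DE this t] have "E t \<le> exp (- (2 * r) * t) * E 0" by simp
  have \<mu>: "0 \<le> \<mu>" "\<mu> \<le> 1 + \<theta>"
  proof -
    have "\<sigma>lo\<^sup>2 \<le> (1 + \<theta>)\<^sup>2" using lohi hi by (intro power_mono) auto
    also have "\<dots> \<le> 2 * (1 + \<theta>)" unfolding power2_eq_square using \<theta> by (intro mult_right_mono) auto
    finally show "\<mu> \<le> 1 + \<theta>" unfolding \<mu>_def by simp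
  qed (simp add: \<mu>_def)
  have "(norm (x t))\<^sup>2 \<le> E t"
    using \<mu> by (simp add: E_def power2_norm_eq_inner)
  also have "\<dots> \<le> exp (- (2 * r) * t) * E 0" by fact
  also have "\<dots> \<le> exp (- (2 * r) * t) * ((norm (x 0))\<^sup>2 + (1 + \<theta>) * (norm (Q 0))\<^sup>2)"
    using \<mu> by (simp add: E_def power2_norm_eq_inner mult_right_mono)
  also have "\<dots> = (exp (- r * t))\<^sup>2 * ((norm (x 0))\<^sup>2 + (1 + \<theta>) * (norm (Q 0))\<^sup>2)"
    by (simp add: exp_double[symmetric] mult.assoc)
  finally have "norm (x t) \<le> sqrt ((exp (- r * t))\<^sup>2 * ((norm (x 0))\<^sup>2 + (1 + \<theta>) * (norm (Q 0))\<^sup>2))"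
    by (rule real_le_rsqrt)
  then show ?thesis by (simp add: real_sqrt_mult x_def r_def \<rho>_def)
qed

theorem theorem7:
  fixes f :: "real \<Rightarrow> real"
    and G L :: "real^('x::finite \<times> 'x)^('x \<times> 'x)"
    and V :: "real^('t::{finite,linorder} \<times> ('x \<times> 'x))"
    and a b c h T \<theta> \<sigma>lo \<sigma>hi \<kappa> \<epsilon> \<gamma> :: real
    and \<Phi> :: "real^('t \<times> ('x \<times> 'x)) \<Rightarrow> real^('t \<times> ('x \<times> 'x))"
  assumes "a \<ge> 0" and "b \<ge> 0" and "c \<ge> 0"
    and "f C1_differentiable_on UNIV" and "\<exists>C. C-lipschitz_on UNIV f"
    and "self_adjoint G" and "nonneg_definite G"
    and "self_adjoint L" and "nonneg_definite L"
    and "G ** L = L ** G"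
    and "h > 0" and T: "T = real CARD('t) * h"
    and theta: "\<theta> = b * T * Lip (\<lambda>u. f u - c * u) * zeta a b c G L h"
    and "\<theta> < 1"
    and Phi: "\<Phi> = F_hat a b c h f G L V"
    and sigma_lo: "\<sigma>lo = (INF U. sigma_min (jacobian \<Phi> (at U)))"
    and sigma_hi: "\<sigma>hi = (SUP U. sigma_max (jacobian \<Phi> (at U)))"
    and kappa: "\<kappa> = \<sigma>hi / \<sigma>lo"
    and epsilon: "\<epsilon> = \<kappa> - 1 / 2"
    and gamma: "\<gamma> = 1 / \<kappa> - 1 / (2 * \<kappa>\<^sup>2)"
  shows "(\<exists>!U. \<Phi> U = 0) \<and>
    (\<forall>U Q. pdhg_solution \<epsilon> \<gamma> \<Phi> U Q \<longrightarrow>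
      (\<forall>t\<ge>0. norm (\<Phi> (U t)) \<le>
        exp (- (5 / 32) * ((1 - \<theta>) ^ 3 / (1 + \<theta>)) * t) *
        sqrt ((norm (\<Phi> (U 0)))\<^sup>2 + (1 + \<theta>) * (norm (Q 0))\<^sup>2)))"
proof (intro conjI allI impI)
  have "h \<ge> 0" using \<open>h > 0\<close> by simp
  note pert = F_hat_perturbation[OF assms(1-3) this assms(6-10) assms(5) Phi theta[unfolded T]]
  have "invertible (M_op a b c h G L :: real^('t \<times> ('x \<times> 'x))^('t \<times> ('x \<times> 'x)))"
    using invertible_M_op[OF assms(1-3) \<open>h \<ge> 0\<close> assms(6-10)] by blast
  then have diff: "\<Phi> differentiable (at U)" for U
    unfolding Phi using \<open>f C1_differentiable_on UNIV\<close> by (rule F_hat_differentiable)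
  \<comment> \<open>Roots of \<open>\<Phi>\<close> are the fixed points of
    \<open>U - \<Phi> U\<close>, and the perturbation bound makes this map a contraction.\<close>
  have "dist (X - \<Phi> X) (Y - \<Phi> Y) \<le> \<theta> * dist X Y" for X Y
    using pert(2)[of Y X] by (simp add: dist_norm algebra_simps norm_minus_commute)
  then have "\<exists>!U. U - \<Phi> U = U"
    using pert(1) \<open>\<theta> < 1\<close> by (intro banach_fix_type) auto
  then show "\<exists>!U. \<Phi> U = 0" by simp
  fix U Q and t :: real
  assume "pdhg_solution \<epsilon> \<gamma> \<Phi> U Q" "0 \<le> t"
  then show "norm (\<Phi> (U t)) \<le> exp (- (5 / 32) * ((1 - \<theta>) ^ 3 / (1 + \<theta>)) * t) *
      sqrt ((norm (\<Phi> (U 0)))\<^sup>2 + (1 + \<theta>) * (norm (Q 0))\<^sup>2)"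
    by (rule pdhg_flow_decay[OF diff pert(2) pert(1) \<open>\<theta> < 1\<close> sigma_lo sigma_hi kappa epsilon gamma])
qed

end
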